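(* A graph $G$ admits an identical biarithmetic IASI if and only if $G$ is bipartite.
   Context: All graphs are simple and finite with no isolated vertices. Let $\mathbb{N}_0$ be the set of non-negative integers and $\mathcal{P}(\mathbb{N}_0)$ its power set; label sets are finite and non-empty. For sets $A,B$, $A+B=\{a+b: a\in A, b\in B\}$. An integer additive set-indexer (IASI) of $G$ is an injective map $f:V(G)\to\mathcal{P}(\mathbb{N}_0)$ such that $f^+:E(G)\to\mathcal{P}(\mathbb{N}_0)$, $f^+(uv)=f(u)+f(v)$, is also injective. An AP-set is a finite set of integers with at least three elements forming an arithmetic progression; its common difference is the deterministic index of the element it labels. An IASI is arithmetic if all vertex labels and edge labels are AP-sets. The deterministic ratio of an edge is the ratio ($\ge 1$) of the larger to the smaller deterministic index of its end vertices. A biarithmetic IASI is an arithmetic IASI $f$ such that for every edge $uv$, writing $d_u\le d_v$ for the deterministic indices of its ends, $d_v=k\,d_u$ for some integer $k$ with $1<k\le |f(u)|$. A biarithmetic IASI is identical if all edges of $G$ have the same deterministic ratio. *)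

theory Defs
  imports Complex_Main "HOL-Library.Set_Algebras"
begin

definition simple_graph :: "'a set \<Rightarrow> 'a set set \<Rightarrow> bool" where
  "simple_graph V E \<longleftrightarrow> finite V \<and> (\<forall>e\<in>E. e \<subseteq> V \<and> card e = 2)"

definition no_isolated :: "'a set \<Rightarrow> 'a set set \<Rightarrow> bool" where
  "no_isolated V E \<longleftrightarrow> (\<forall>v\<in>V. \<exists>e\<in>E. v \<in> e)"

definition bipartite :: "'a set \<Rightarrow> 'a set set \<Rightarrow> bool" where
  "bipartite V E \<longleftrightarrow>
     (\<exists>X Y. X \<union> Y = V \<and> X \<inter> Y = {} \<and> (\<forall>e\<in>E. \<exists>x\<in>X. \<exists>y\<in>Y. e = {x, y}))"

text \<open>
  The induced edge map \<open>f\<^sup>+\<close>. The sum is taken in the commutative monoid of sets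
  under \<open>A + B = {a + b | a \<in> A, b \<in> B}\<close>, so that an unordered edge \<open>{u, v}\<close>
  gets \<open>f u + f v\<close>.
\<close>

definition edge_label :: "('a \<Rightarrow> nat set) \<Rightarrow> 'a set \<Rightarrow> nat set" where
  "edge_label f e = (\<Sum>v\<in>e. f v)"

lemma edge_label_pair: "u \<noteq> v \<Longrightarrow> edge_label f {u, v} = {a + b | a b. a \<in> f u \<and> b \<in> f v}"
  by (auto simp: edge_label_def set_plus_def)

definition IASI :: "'a set \<Rightarrow> 'a set set \<Rightarrow> ('a \<Rightarrow> nat set) \<Rightarrow> bool" where
  "IASI V E f \<longleftrightarrow>
     (\<forall>v\<in>V. finite (f v) \<and> f v \<noteq> {}) \<and> inj_on f V \<and> inj_on (edge_label f) E"

definition arith_prog :: "nat set \<Rightarrow> nat \<Rightarrow> bool" where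
  "arith_prog A d \<longleftrightarrow> (\<exists>a. A = {a + i * d | i. i < card A})"

definition AP_set :: "nat set \<Rightarrow> bool" where
  "AP_set A \<longleftrightarrow> finite A \<and> 3 \<le> card A \<and> (\<exists>d. arith_prog A d)"

text \<open>The common difference; unique and positive on AP-sets, unspecified on other sets.\<close>

definition det_index :: "nat set \<Rightarrow> nat" where
  "det_index A = (THE d. arith_prog A d)"

lemma arith_prog_unique:
  assumes card: "2 \<le> card A" and d: "arith_prog A d" and d': "arith_prog A d'"
  shows "d' = d"
proof -
  have *: "Min A + x = Min (A - {Min A})" if "arith_prog A x" for x
  proof -
    obtain a where A: "A = {a + i * x | i. i < card A}"
      using \<open>arith_prog A x\<close> unfolding arith_prog_def by blast
    have fin: "finite A" using card by (metis card.infinite not_numeral_le_zero)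
    have x: "x > 0"
    proof (rule ccontr)
      assume "\<not> x > 0"
      then have "A \<subseteq> {a}" using A by auto
      then have "card A \<le> 1" by (metis card.empty card_insert_le_m1 card_mono finite.intros
            is_singletonI is_singleton_altdef order_refl)
      then show False using card by simp
    qed
    have a: "a \<in> A" using card by (subst A) (auto intro: exI[of _ 0])
    have le: "a \<le> y" if "y \<in> A" for y using that by (subst (asm) A) auto
    have Min: "Min A = a" using fin a le by (intro Min_eqI) auto
    have "a + x \<in> A" using card by (subst A) (auto intro: exI[of _ 1])
    moreover have "a + x \<le> y" if "y \<in> A - {a}" for y
    proof -
      have "y \<in> A" "y \<noteq> a" using that by auto
      then obtain i where "y = a + i * x" using A by blast
      moreover have "i \<noteq> 0" using calculation \<open>y \<noteq> a\<close> by auto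
      ultimately show ?thesis by (cases i) auto
    qed
    ultimately have "Min (A - {a}) = a + x" using fin x by (intro Min_eqI) auto
    then show ?thesis using Min by simp
  qed
  show ?thesis using *[OF d] *[OF d'] by simp
qed

lemma det_index_eq:
  assumes "AP_set A" and "arith_prog A d"
  shows "det_index A = d"
proof -
  have "2 \<le> card A" using assms(1) by (simp add: AP_set_def)
  then show ?thesis
    unfolding det_index_def using assms(2) arith_prog_unique by (intro the_equality) blast+
qed

definition arithmetic_IASI :: "'a set \<Rightarrow> 'a set set \<Rightarrow> ('a \<Rightarrow> nat set) \<Rightarrow> bool" where
  "arithmetic_IASI V E f \<longleftrightarrow>
     IASI V E f \<and> (\<forall>v\<in>V. AP_set (f v)) \<and> (\<forall>e\<in>E. AP_set (edge_label f e))"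

definition det_ratio :: "('a \<Rightarrow> nat set) \<Rightarrow> 'a set \<Rightarrow> real" where
  "det_ratio f e =
     real (Max ((\<lambda>v. det_index (f v)) ` e)) / real (Min ((\<lambda>v. det_index (f v)) ` e))"

definition biarithmetic_IASI :: "'a set \<Rightarrow> 'a set set \<Rightarrow> ('a \<Rightarrow> nat set) \<Rightarrow> bool" where
  "biarithmetic_IASI V E f \<longleftrightarrow>
     arithmetic_IASI V E f \<and>
     (\<forall>u v. {u, v} \<in> E \<longrightarrow> det_index (f u) \<le> det_index (f v) \<longrightarrow>
        (\<exists>k::nat. 1 < k \<and> k \<le> card (f u) \<and> det_index (f v) = k * det_index (f u)))"

definition identical_biarithmetic_IASI ::
    "'a set \<Rightarrow> 'a set set \<Rightarrow> ('a \<Rightarrow> nat set) \<Rightarrow> bool" where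
  "identical_biarithmetic_IASI V E f \<longleftrightarrow>
     biarithmetic_IASI V E f \<and> (\<forall>e\<in>E. \<forall>e'\<in>E. det_ratio f e = det_ratio f e')"

end

(* Along an edge the deterministic index is multiplied by the common ratio k, so the exponent of k
   in the index changes by one and its parity is a proper 2-colouring. Conversely, label one colour
   class by progressions of difference 1 and the other by progressions of difference 2, all of
   length 3; every edge label is then a block of 7 consecutive integers, determined by its least
   element, and starting points g x and N * g y, with g an injection into {..<N}, make all of
   these distinct. *)

theory Submission imports Defs "HOL-Computational_Algebra.Euclidean_Algorithm" begin

text \<open>The length is an explicit parameter, whereas \<open>arith_prog\<close> refers back to
  \<open>card A\<close>; for \<open>d > 0\<close> the two agree.\<close>

definition progression :: "nat \<Rightarrow> nat \<Rightarrow> nat \<Rightarrow> nat set" where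
  "progression a d n = (\<lambda>i. a + i * d) ` {..<n}"

lemma finite_progression [simp]: "finite (progression a d n)"
  by (simp add: progression_def)

lemma card_progression [simp]: "d > 0 \<Longrightarrow> card (progression a d n) = n"
  by (simp add: progression_def card_image inj_on_def)

lemma Min_progression: "n > 0 \<Longrightarrow> Min (progression a d n) = a"
  by (rule Min_eqI) (auto simp: progression_def)

lemma arith_prog_progression: "d > 0 \<Longrightarrow> arith_prog (progression a d n) d"
  unfolding arith_prog_def card_progression
  by (rule exI[of _ a]) (auto simp: progression_def)

lemma AP_set_progression: "d > 0 \<Longrightarrow> 3 \<le> n \<Longrightarrow> AP_set (progression a d n)"
  unfolding AP_set_def using arith_prog_progression by auto

lemma det_index_progression: "d > 0 \<Longrightarrow> 3 \<le> n \<Longrightarrow> det_index (progression a d n) = d"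
  by (simp add: det_index_eq AP_set_progression arith_prog_progression)

text \<open>The start is the minimum. This turns both injectivity claims about labels into equations
  between starting points.\<close>

lemma progression_start_eq:
  assumes "progression a d n = progression b c n" and "n > 0"
  shows "a = b"
  using assms Min_progression by metis

text \<open>Difference 0 would leave at most one element, against the required three. Positivity is
  what makes ratios and multiplicities of indices meaningful.\<close>

lemma AP_set_det_index_pos:
  assumes "AP_set A"
  shows "det_index A > 0"
proof (rule ccontr)
  assume "\<not> det_index A > 0"
  moreover obtain d where d: "arith_prog A d" using assms by (auto simp: AP_set_def)
  ultimately have "arith_prog A 0" using det_index_eq[OF assms d] by simp
  then obtain a where "A \<subseteq> {a}" by (auto simp: arith_prog_def)
  then have "card A \<le> card {a}" by (intro card_mono) auto
  then show False using assms by (simp add: AP_set_def)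
qed

text \<open>The offsets \<open>i + j * 2\<close> with \<open>i\<close> and \<open>j\<close> in 0..2
  fill 0..6 without a gap.\<close>

lemma edge_label_progressions:
  assumes "u \<noteq> v" "f u = progression a 1 3" "f v = progression b 2 3"
  shows "edge_label f {u, v} = progression (a + b) 1 7"
proof -
  have "edge_label f {u, v} = {(a + i * 1) + (b + j * 2) | i j. i \<in> {..<3} \<and> j \<in> {..<3}}"
    unfolding edge_label_pair[OF \<open>u \<noteq> v\<close>] assms(2,3) progression_def by blast
  also have "\<dots> = {a + b + (i + j * 2) | i j. i < 3 \<and> j < 3}" by (simp add: ac_simps)
  also have "\<dots> = progression (a + b) 1 7"
  proof (intro subset_antisym subsetI)
    fix x assume "x \<in> progression (a + b) 1 7"
    then obtain m where m: "m < 7" "x = a + b + m" by (auto simp: progression_def)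
    \<comment> \<open>The cap at 2 matters only for \<open>m = 6\<close>, where
      \<open>m div 2\<close> is 3; there the remainder \<open>m - j * 2\<close> is 2, still below
      3.\<close>
    define j where "j = min (m div 2) 2"
    have "x = a + b + ((m - j * 2) + j * 2)" "m - j * 2 < 3" "j < 3"
      using m unfolding j_def by linarith+
    then show "x \<in> {a + b + (i + j * 2) | i j. i < 3 \<and> j < 3}" by blast
  qed (auto simp: progression_def)
  finally show ?thesis .
qed

lemma det_ratio_mult:
  assumes "det_index (f v) = k * det_index (f u)" "k \<ge> 1" "det_index (f u) > 0"
  shows "det_ratio f {u, v} = real k"
proof -
  have "det_index (f u) \<le> det_index (f v)" using assms by simp
  then show ?thesis using assms by (simp add: det_ratio_def max_def min_def)
qed

text \<open>The even and the odd values of \<open>h\<close> give the two colour classes.\<close>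

lemma bipartite_if_parity_alternates:
  fixes h :: "'a \<Rightarrow> nat"
  assumes "simple_graph V E"
    and alt: "\<And>u v. {u, v} \<in> E \<Longrightarrow> u \<noteq> v \<Longrightarrow> even (h u) \<longleftrightarrow> odd (h v)"
  shows "bipartite V E"
proof -
  define X where "X = {v \<in> V. even (h v)}"
  have "\<exists>x\<in>X. \<exists>y\<in>V - X. e = {x, y}" if e: "e \<in> E" for e
  proof -
    have "card e = 2" "e \<subseteq> V" using assms(1) e by (auto simp: simple_graph_def)
    then obtain u v where uv: "e = {u, v}" "u \<noteq> v" "u \<in> V" "v \<in> V"
      by (auto simp: card_2_iff)
    have parity: "even (h u) \<longleftrightarrow> odd (h v)" using alt[of u v] e uv by simp
    show ?thesis
    proof (cases "even (h u)")
      case True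
      then have "u \<in> X" "v \<in> V - X" using uv parity by (auto simp: X_def)
      then show ?thesis using uv(1) by blast
    next
      case False
      then have "v \<in> X" "u \<in> V - X" using uv parity by (auto simp: X_def)
      then show ?thesis using uv(1) by blast
    qed
  qed
  moreover have "X \<union> (V - X) = V" by (auto simp: X_def)
  ultimately show ?thesis unfolding bipartite_def by blast
qed

lemma bipartite_if_identical_biarithmetic_IASI:
  assumes graph: "simple_graph V E" and f: "identical_biarithmetic_IASI V E f"
  shows "bipartite V E"
proof -
  have inV: "u \<in> V" "v \<in> V" if "{u, v} \<in> E" for u v
    using graph that by (auto simp: simple_graph_def)
  have pos: "det_index (f v) > 0" if "v \<in> V" for v
    using f that AP_set_det_index_pos
    by (auto simp: identical_biarithmetic_IASI_def biarithmetic_IASI_def arithmetic_IASI_def)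
  have step: "\<exists>k>1. det_index (f v) = k * det_index (f u) \<and> det_ratio f {u, v} = real k"
    if uv: "{u, v} \<in> E" and le: "det_index (f u) \<le> det_index (f v)" for u v
  proof -
    obtain k where "1 < k" "det_index (f v) = k * det_index (f u)"
      using f uv le unfolding identical_biarithmetic_IASI_def biarithmetic_IASI_def by blast
    then show ?thesis using det_ratio_mult[of f v k u] pos[OF inV(1)[OF uv]] by auto
  qed
  \<comment> \<open>The ratio of an arbitrary edge, turned from a real into a natural number.
    Without edges the value is unspecified, but every fact about \<open>k\<close> below assumes an
    edge.\<close>
  define k where "k = nat \<lfloor>det_ratio f (SOME e. e \<in> E)\<rfloor>"
  have ratio: "nat \<lfloor>det_ratio f e\<rfloor> = k" if "e \<in> E" for e
    using f that someI[of "\<lambda>e. e \<in> E" e]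
    unfolding k_def identical_biarithmetic_IASI_def by metis
  have mult: "k > 1 \<and> det_index (f v) = k * det_index (f u)"
    if "{u, v} \<in> E" "det_index (f u) \<le> det_index (f v)" for u v
    using step[OF that] ratio[OF that(1)] by auto
  \<comment> \<open>Since \<open>k > 1\<close> is not a unit and the index is nonzero, one more
    factor \<open>k\<close> raises the multiplicity by exactly one; \<open>k\<close> need not be
    prime.\<close>
  have exponent: "multiplicity k (det_index (f v)) = Suc (multiplicity k (det_index (f u)))"
    if "{u, v} \<in> E" "det_index (f u) \<le> det_index (f v)" for u v
    using mult[OF that] pos[OF inV(1)[OF that(1)]] by (simp add: multiplicity_times_same)
  show ?thesis
  proof (rule bipartite_if_parity_alternates[OF graph])
    fix u v assume "{u, v} \<in> E"
    \<comment> \<open>Either end may have the larger index, so \<open>exponent\<close> is needed in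
      both orientations.\<close>
    moreover from this have "{v, u} \<in> E" by (simp add: insert_commute)
    ultimately show "even (multiplicity k (det_index (f u))) \<longleftrightarrow> odd (multiplicity k (det_index (f v)))"
      using exponent[of u v] exponent[of v u]
        linear[of "det_index (f u)" "det_index (f v)"] by fastforce
  qed
qed

lemma identical_biarithmetic_IASI_if_bipartite:
  assumes "finite V" and "bipartite V E"
  shows "\<exists>f. identical_biarithmetic_IASI V E f"
proof -
  obtain X Y where V: "V = X \<union> Y" and disj: "X \<inter> Y = {}"
    and E: "\<And>e. e \<in> E \<Longrightarrow> \<exists>x\<in>X. \<exists>y\<in>Y. e = {x, y}"
    using assms(2) unfolding bipartite_def by metis
  obtain g :: "'a \<Rightarrow> nat" and N where g: "inj_on g V" "g ` V = {i. i < N}"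
    using finite_imp_inj_to_nat_seg[OF assms(1)] by metis
  \<comment> \<open>The starts at the ends of an edge add up to a number with base-\<open>N\<close>
    digits \<open>g x\<close> and \<open>g y\<close>.\<close>
  define f where
    "f v = (if v \<in> X then progression (g v) 1 3 else progression (N * g v) 2 3)" for v
  have fX: "f x = progression (g x) 1 3" if "x \<in> X" for x
    using that by (simp add: f_def)
  have fY: "f y = progression (N * g y) 2 3" if "y \<in> Y" for y
    using that disj by (auto simp: f_def)
  have dX: "det_index (f x) = 1" if "x \<in> X" for x
    using that by (simp add: fX det_index_progression)
  have dY: "det_index (f y) = 2" if "y \<in> Y" for y
    using that by (simp add: fY det_index_progression)
  have gN: "g v < N" if "v \<in> V" for v using g(2) that by blast
  have label: "edge_label f {x, y} = progression (g x + N * g y) 1 7" if "x \<in> X" "y \<in> Y" for x y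
    using that disj by (intro edge_label_progressions fX fY) auto
  have "inj_on f V"
  proof (rule inj_onI)
    fix u v assume uv: "u \<in> V" "v \<in> V" and eq: "f u = f v"
    \<comment> \<open>The differences 1 and 2 tell the colour classes apart, so starts are compared
      only within a class.\<close>
    have same: "u \<in> X \<longleftrightarrow> v \<in> X"
      using uv dX dY eq V by (metis UnE one_eq_numeral_iff num.distinct(1))
    have "g u = g v"
    proof (cases "u \<in> X")
      case True
      then show ?thesis using eq same fX progression_start_eq[of "g u" 1 3 "g v" 1] by simp
    next
      case False
      then have "N * g u = N * g v"
        using eq same uv V fY progression_start_eq[of "N * g u" 2 3 "N * g v" 2] by auto
      \<comment> \<open>The bound \<open>g u < N\<close> gives \<open>N > 0\<close>, so
        \<open>N\<close> cancels.\<close>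
      then show ?thesis using gN[OF uv(1)] by simp
    qed
    then show "u = v" using g(1) uv by (simp add: inj_on_def)
  qed
  moreover have "inj_on (edge_label f) E"
  proof (rule inj_onI)
    fix e e' assume e: "e \<in> E" "e' \<in> E" and eq: "edge_label f e = edge_label f e'"
    obtain x y where xy: "x \<in> X" "y \<in> Y" "e = {x, y}" using E[OF e(1)] by blast
    obtain x' y' where xy': "x' \<in> X" "y' \<in> Y" "e' = {x', y'}" using E[OF e(2)] by blast
    have sum: "g x + N * g y = g x' + N * g y'"
      using eq xy xy' label
        progression_start_eq[of "g x + N * g y" 1 7 "g x' + N * g y'" 1] by simp
    have lt: "g x < N" "g x' < N" using gN V xy xy' by auto
    \<comment> \<open>Reduction modulo \<open>N\<close> reads off the low digit; cancelling it then
      leaves the high one.\<close>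
    have "g x = g x'" using arg_cong[OF sum, of "\<lambda>n. n mod N"] lt by simp
    moreover have "g y = g y'" using sum calculation lt by simp
    ultimately show "e = e'" using inj_onD[OF g(1)] V xy xy' by blast
  qed
  moreover have "\<forall>v\<in>V. AP_set (f v)" by (simp add: f_def AP_set_progression)
  moreover have "\<forall>e\<in>E. AP_set (edge_label f e)"
  proof
    fix e assume "e \<in> E"
    then obtain x y where "x \<in> X" "y \<in> Y" "e = {x, y}" using E by blast
    then show "AP_set (edge_label f e)" by (simp add: label AP_set_progression)
  qed
  ultimately have "arithmetic_IASI V E f"
    by (auto simp: arithmetic_IASI_def IASI_def AP_set_def)
  moreover have "\<exists>k::nat. 1 < k \<and> k \<le> card (f u) \<and> det_index (f v) = k * det_index (f u)"
    if uv: "{u, v} \<in> E" and le: "det_index (f u) \<le> det_index (f v)" for u v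
  proof -
    obtain x y where "x \<in> X" "y \<in> Y" "{u, v} = {x, y}" using E[OF uv] by blast
    \<comment> \<open>The end with the smaller index must be the one in \<open>X\<close>, as the
      indices are 1 and 2.\<close>
    then have "u \<in> X \<and> v \<in> Y" using le dX dY by (auto simp: doubleton_eq_iff)
    \<comment> \<open>The factor 2 is admissible because the label of \<open>u\<close> has 3
      elements.\<close>
    then show ?thesis using dX dY fX by (intro exI[of _ 2]) simp
  qed
  moreover have "det_ratio f e = 2" if e: "e \<in> E" for e
  proof -
    obtain x y where "x \<in> X" "y \<in> Y" "e = {x, y}" using E[OF e] by blast
    then show ?thesis using det_ratio_mult[of f y 2 x] dX dY by simp
  qed
  ultimately show ?thesis
    unfolding identical_biarithmetic_IASI_def biarithmetic_IASI_def by metis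
qed

theorem theorem3p4:
  fixes V :: "'a set" and E :: "'a set set"
  assumes "simple_graph V E" and "no_isolated V E"
  shows "(\<exists>f. identical_biarithmetic_IASI V E f) \<longleftrightarrow> bipartite V E"
proof -
  have "finite V" using assms(1) by (simp add: simple_graph_def)
  then show ?thesis
    using bipartite_if_identical_biarithmetic_IASI[OF assms(1)]
      identical_biarithmetic_IASI_if_bipartite by blast
qed

end
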